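(* Let $N_r=n_1n_2\cdots n_K$ with $n_1,\dots,n_K$ positive integers, let $\Theta\in\mathbb{R}$, and let $\mathbf v(\Theta)=[1,e^{\mathrm j\Theta},\dots,e^{\mathrm j(N_r-1)\Theta}]$. Then $$\mathbf v(\Theta)=[1,e^{\mathrm j\Theta},\dots,e^{\mathrm j(n_1-1)\Theta}]\otimes[1,e^{\mathrm jn_1\Theta},\dots,e^{\mathrm j(n_2-1)n_1\Theta}]\otimes\cdots\otimes[1,e^{\mathrm jn_{K-1}\cdots n_2n_1\Theta},\dots,e^{\mathrm j(n_K-1)n_{K-1}\cdots n_2n_1\Theta}],$$ where $\otimes$ denotes the left Kronecker product.
   Context: $\mathrm j$ denotes the imaginary unit. The left Kronecker product of vectors $\mathbf a$ (length $p$) and $\mathbf b=[b_1,\dots,b_q]$ is the vector of length $pq$ given by $\mathbf a\otimes\mathbf b=[b_1\mathbf a,\,b_2\mathbf a,\dots,b_q\mathbf a]$ (so the index of $\mathbf a$ varies fastest). It is associative. All vectors are written here as lists of entries, disregarding the distinction between rows and columns. *)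

theory Defs
  imports Complex_Main
begin

text \<open>Vectors are lists of entries. In the left Kronecker product
  \<open>[b\<^sub>1 a, b\<^sub>2 a, \<dots>, b\<^sub>q a]\<close> the index of the left factor varies fastest.\<close>

definition lkron :: "'a::semiring_1 list \<Rightarrow> 'a list \<Rightarrow> 'a list"  (infixl \<open>\<otimes>\<^sub>L\<close> 70)
  where "a \<otimes>\<^sub>L b = concat (map (\<lambda>y. map (\<lambda>x. y * x) a) b)"

lemma lkron_assoc: "(a \<otimes>\<^sub>L b) \<otimes>\<^sub>L c = a \<otimes>\<^sub>L (b \<otimes>\<^sub>L c)"
proof -
  have scale: "a \<otimes>\<^sub>L map (\<lambda>x. z * x) b = map (\<lambda>x. z * x) (a \<otimes>\<^sub>L b)" for z
    by (induction b) (simp_all add: lkron_def mult.assoc)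
  have app: "a \<otimes>\<^sub>L (u @ v) = (a \<otimes>\<^sub>L u) @ (a \<otimes>\<^sub>L v)" for u v
    by (simp add: lkron_def)
  show ?thesis
  proof (induction c)
    case Nil
    show ?case by (simp add: lkron_def)
  next
    case (Cons z c)
    have cons: "d \<otimes>\<^sub>L (z # c) = map (\<lambda>x. z * x) d @ (d \<otimes>\<^sub>L c)" for d
      by (simp add: lkron_def)
    show ?case
      by (simp only: cons app scale Cons.IH)
  qed
qed

text \<open>Iterated product \<open>a\<^sub>1 \<otimes>\<^sub>L a\<^sub>2 \<otimes>\<^sub>L \<dots> \<otimes>\<^sub>L a\<^sub>K\<close>, bracketed to the left; the empty
  product is the unit vector \<open>[1]\<close> of length 1.\<close>

fun lkron_list :: "'a::semiring_1 list list \<Rightarrow> 'a list"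
  where
    "lkron_list [] = [1]"
  | "lkron_list (a # as) = foldl (\<otimes>\<^sub>L) a as"

end

theory Submission
  imports Defs
begin

text \<open>With \<open>z = e\<^bsup>j\<Theta>\<^esup>\<close> every factor is a list of powers of \<open>z\<close>. Writing each exponent below
  \<open>M * q\<close> uniquely as \<open>m + M * i\<close> with \<open>m < M\<close> and \<open>i < q\<close> splits off the last factor:
  \<open>[1, z, \<dots>, z\<^bsup>M q - 1\<^esup>] = [1, z, \<dots>, z\<^bsup>M - 1\<^esup>] \<otimes>\<^sub>L [1, z\<^bsup>M\<^esup>, \<dots>, z\<^bsup>M (q - 1)\<^esup>]\<close>.
  Induction on the number of factors does the rest.\<close>

text \<open>\<open>foldl\<close> brackets to the left, so the last factor is outermost; for empty
  \<open>as\<close>, \<open>[1]\<close> acts as a left unit.\<close>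

lemma lkron_list_snoc: "lkron_list (as @ [a]) = lkron_list as \<otimes>\<^sub>L a"
  by (cases as) (simp_all add: lkron_def)

lemma lkron_powers:
  fixes z :: "'a::semiring_1"
  shows "map (\<lambda>m. z ^ m) [0..<M] \<otimes>\<^sub>L map (\<lambda>i. z ^ (i * M)) [0..<q] = map (\<lambda>m. z ^ m) [0..<M * q]"
proof (induction q)
  case 0
  show ?case by (simp add: lkron_def)
next
  case (Suc q)
  \<comment> \<open>The block that the new entry \<open>z ^ (q * M)\<close> of the right factor
    contributes.\<close>
  have "map (\<lambda>m. z ^ (q * M) * z ^ m) [0..<M] = map (\<lambda>m. z ^ m) [M * q..<M * q + M]"
    by (rule nth_equalityI) (simp_all add: power_add mult.commute)
  moreover have "[0..<M * Suc q] = [0..<M * q] @ [M * q..<M * q + M]"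
    using upt_add_eq_append[of 0 "M * q" M] by (simp add: add.commute)
  ultimately show ?case
    using Suc.IH by (simp add: lkron_def comp_def)
qed

lemma lkron_list_powers:
  fixes z :: "'a::semiring_1"
  shows "lkron_list (map (\<lambda>k. map (\<lambda>m. z ^ (m * (\<Prod>l=1..<k. n l))) [0..<n k]) [1..<Suc K]) =
    map (\<lambda>m. z ^ m) [0..<(\<Prod>k=1..K. n k)]"
proof (induction K)
  case 0
  show ?case by simp
next
  case (Suc K)
  \<comment> \<open>The stride of the new factor equals the length of the product so far, as
    \<open>lkron_powers\<close> requires.\<close>
  have "(\<Prod>l=1..<Suc K. n l) = (\<Prod>l=1..K. n l)"
    by (simp only: atLeastLessThanSuc_atLeastAtMost)
  moreover have "[1..<Suc (Suc K)] = [1..<Suc K] @ [Suc K]"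
    by simp
  moreover have "(\<Prod>k=1..Suc K. n k) = (\<Prod>k=1..K. n k) * n (Suc K)"
    by simp
  ultimately show ?case
    by (simp only: map_append list.map lkron_list_snoc Suc.IH lkron_powers)
qed

theorem proposition3:
  fixes K :: nat and n :: "nat \<Rightarrow> nat" and \<Theta> :: real
  assumes "K \<ge> 1"
    and "\<And>k. k \<in> {1..K} \<Longrightarrow> n k > 0"
  shows "map (\<lambda>m. exp (\<i> * complex_of_real (real m * \<Theta>))) [0..<(\<Prod>k=1..K. n k)] =
    lkron_list
      (map (\<lambda>k. map (\<lambda>m. exp (\<i> * complex_of_real (real m * real (\<Prod>l=1..<k. n l) * \<Theta>))) [0..<n k])
        [1..<Suc K])"
proof -
  have pow: "exp (\<i> * complex_of_real (real m * \<Theta>)) = exp (\<i> * complex_of_real \<Theta>) ^ m" for m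
    by (simp add: exp_of_nat_mult[symmetric] mult.left_commute)
  show ?thesis
    \<comment> \<open>Merging \<open>m\<close> and the stride into one natural number lets
      \<open>pow\<close> rewrite both sides.\<close>
    by (simp only: of_nat_mult[symmetric] pow lkron_list_powers)
qed

end
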